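(* Let $m\ge3$, $p\ne q\in[m]$, and let $\lambda_1,\lambda_2,\lambda_3$ be $\mathbb{Z}_2$-characteristic maps over $P_m$ with $\lambda_i(p)=\mathbf a$ and $\lambda_i(q)=\mathbf b$ for $i=1,2,3$, such that $\lambda_1,\lambda_2$ are $p$-adjacent and $\lambda_1,\lambda_3$ are $q$-adjacent. Then the following are equivalent: (1) the edges $\{\lambda_1,\lambda_2,p\}$ and $\{\lambda_1,\lambda_3,q\}$ span a realizable square, i.e. there is a $\mathbb{Z}_2$-characteristic map $\Lambda$ over $\mathrm{wed}_{p,q}P_m$ with $\operatorname{proj}_{\{p_2,q_2\}}\Lambda\simeq\lambda_1$, $\operatorname{proj}_{\{p_1,q_2\}}\Lambda\simeq\lambda_2$, $\operatorname{proj}_{\{p_2,q_1\}}\Lambda\simeq\lambda_3$; (2) $\overline{\lambda_1\Delta\lambda_2}\cap(\lambda_1\Delta\lambda_3)=\varnothing$; (3) $\overline{\lambda_1\Delta\lambda_2}\cap\overline{\lambda_1\Delta\lambda_3}=\varnothing$.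
   Context: $P_m$: simplicial complex on $[m]$ with facets $\{i,i+1\}$ mod $m$. $\mathbf a=(1,0)^T,\mathbf b=(0,1)^T,\mathbf c=(1,1)^T$; a $\mathbb{Z}_2$-characteristic map over $P_m$ is a map $[m]\to\{\mathbf a,\mathbf b,\mathbf c\}$ with $\lambda(i)\ne\lambda(i+1)$ mod $m$; $\simeq$ is D-J equivalence (composition with an element of $GL(n,\mathbb{Z}_2)$). For characteristic maps $\mu,\nu$, $\mu\Delta\nu=\{v\in[m]:\mu(v)\ne\nu(v)\}$; for $A\subseteq[m]$, $\overline A=\{v-1,v,v+1 \bmod m: v\in A\}$. Wedges: $\mathrm{wed}_pK$ replaces $p$ by $p_1,p_2$, with minimal non-faces those of $K$ with $p$ replaced by $\{p_1,p_2\}$ when it occurs; $\mathrm{wed}_{p,q}K$ does this for both $p$ and $q$. Projection: $\operatorname{proj}_\sigma\Lambda(w)=[\Lambda(w)]\in\mathbb{Z}_2^n/\langle\Lambda(v):v\in\sigma\rangle$ for $w$ in the link of $\sigma$; links of $p_2$ (resp. $p_1$) in $\mathrm{wed}_pK$ are identified with $K$ via $p_1\mapsto p$ (resp. $p_2\mapsto p$), and the link of $\{p_i,q_j\}$ in $\mathrm{wed}_{p,q}P_m$ with $P_m$ via $p_{3-i}\mapsto p,q_{3-j}\mapsto q$. D-J classes $\lambda,\lambda'$ over $P_m$ are $p$-adjacent if some characteristic map $\Lambda$ over $\mathrm{wed}_pP_m$ has $\operatorname{proj}_{p_2}\Lambda\simeq\lambda$, $\operatorname{proj}_{p_1}\Lambda\simeq\lambda'$.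 *)

theory Defs
  imports "HOL-Analysis.Analysis" "HOL-Library.Z2"
begin

text \<open>Vectors over Z_2: the type bit (HOL-Library.Z2) is the field with two elements;
  Z_2^n is bit^'n for a numeral type 'n.  Vertex set [m] is encoded as {0..<m}.\<close>

definition va :: "bit^2" where "va = (\<chi> i. if i = 0 then 1 else 0)"
definition vb :: "bit^2" where "vb = (\<chi> i. if i = 1 then 1 else 0)"
definition vc :: "bit^2" where "vc = (\<chi> i. 1)"

text \<open>Z_2-characteristic map over P_m (as in the context).\<close>
definition char_Pm :: "nat \<Rightarrow> (nat \<Rightarrow> bit^2) \<Rightarrow> bool" where
  "char_Pm m l \<longleftrightarrow> (\<forall>i<m. l i \<in> {va, vb, vc}) \<and> (\<forall>i<m. l i \<noteq> l (Suc i mod m))"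

text \<open>Faces of P_m: subsets of the facets {i, i+1 mod m}.\<close>
definition Pm_faces :: "nat \<Rightarrow> nat set set" where
  "Pm_faces m = {\<sigma>. \<exists>i<m. \<sigma> \<subseteq> {i, Suc i mod m}}"

text \<open>Minimal non-faces of a complex K on vertex set V.\<close>
definition min_nonfaces :: "'v set \<Rightarrow> 'v set set \<Rightarrow> 'v set set" where
  "min_nonfaces V K = {S. S \<subseteq> V \<and> S \<notin> K \<and> (\<forall>T. T \<subset> S \<longrightarrow> T \<in> K)}"

text \<open>Wedge along a set W of vertices: each w in W is replaced by (w,1),(w,2);
  other vertices v become (v,0).\<close>
definition wed_verts :: "'v set \<Rightarrow> 'v set \<Rightarrow> ('v \<times> nat) set" where
  "wed_verts V W = (\<lambda>v. (v, 0)) ` (V - W) \<union> (W \<times> {1, 2})"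

definition wed_lift :: "'v set \<Rightarrow> 'v set \<Rightarrow> ('v \<times> nat) set" where
  "wed_lift W S = (\<lambda>v. (v, 0)) ` (S - W) \<union> ((S \<inter> W) \<times> {1, 2})"

text \<open>Faces of wed_W K: vertex subsets containing no minimal non-face of wed_W K,
  where the minimal non-faces are those of K with each w in W replaced by {w_1,w_2}.\<close>
definition wed :: "'v set \<Rightarrow> 'v set \<Rightarrow> 'v set set \<Rightarrow> ('v \<times> nat) set set" where
  "wed V W K = {\<sigma>. \<sigma> \<subseteq> wed_verts V W \<and> (\<forall>N \<in> min_nonfaces V K. \<not> wed_lift W N \<subseteq> \<sigma>)}"

text \<open>Z_2-characteristic map over a complex K (target Z_2^n):
  images of every face are distinct and linearly independent.\<close>
definition char_map :: "'v set set \<Rightarrow> ('v \<Rightarrow> bit^'n) \<Rightarrow> bool" where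
  "char_map K \<Lambda> \<longleftrightarrow> (\<forall>\<sigma>\<in>K. inj_on \<Lambda> \<sigma> \<and> vec.independent (\<Lambda> ` \<sigma>))"

text \<open>proj_\<sigma> \<Lambda> \<simeq> \<lambda>, where the link of \<sigma> is identified with P_m via \<iota>:
  there is an isomorphism from Z_2^n / <\<Lambda>(v) : v\<in>\<sigma>> onto Z_2^2 carrying
  [\<Lambda>(\<iota> w)] to \<lambda>(w).  Such an isomorphism is the same thing as a surjective linear
  map Z_2^n \<rightarrow> Z_2^2 whose kernel is the span of \<Lambda>(\<sigma>).\<close>
definition proj_equiv ::
  "nat \<Rightarrow> ('v \<Rightarrow> bit^'n) \<Rightarrow> 'v set \<Rightarrow> (nat \<Rightarrow> 'v) \<Rightarrow> (nat \<Rightarrow> bit^2) \<Rightarrow> bool" where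
  "proj_equiv m \<Lambda> \<sigma> \<iota> l \<longleftrightarrow>
     (\<exists>\<phi> :: bit^'n \<Rightarrow> bit^2.
        Vector_Spaces.linear (*s) (*s) \<phi> \<and> surj \<phi> \<and>
        {x. \<phi> x = 0} = vec.span (\<Lambda> ` \<sigma>) \<and>
        (\<forall>w<m. \<phi> (\<Lambda> (\<iota> w)) = l w))"

text \<open>Identification of P_m-vertices with wedge vertices: v in W goes to (v, f v).\<close>
definition wid :: "nat set \<Rightarrow> (nat \<Rightarrow> nat) \<Rightarrow> nat \<Rightarrow> nat \<times> nat" where
  "wid W f v = (if v \<in> W then (v, f v) else (v, 0))"

text \<open>p-adjacency: some \<Lambda> over wed_p P_m with proj_{p_2} \<Lambda> \<simeq> l (link identified via
  p_1 \<mapsto> p) and proj_{p_1} \<Lambda> \<simeq> l' (link identified via p_2 \<mapsto> p).\<close>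
definition p_adjacent :: "nat \<Rightarrow> nat \<Rightarrow> (nat \<Rightarrow> bit^2) \<Rightarrow> (nat \<Rightarrow> bit^2) \<Rightarrow> bool" where
  "p_adjacent m p l l' \<longleftrightarrow>
     (\<exists>\<Lambda> :: nat \<times> nat \<Rightarrow> bit^3.
        char_map (wed {0..<m} {p} (Pm_faces m)) \<Lambda> \<and>
        proj_equiv m \<Lambda> {(p, 2)} (wid {p} (\<lambda>_. 1)) l \<and>
        proj_equiv m \<Lambda> {(p, 1)} (wid {p} (\<lambda>_. 2)) l')"

definition sdiff_maps :: "nat \<Rightarrow> (nat \<Rightarrow> bit^2) \<Rightarrow> (nat \<Rightarrow> bit^2) \<Rightarrow> nat set" where
  "sdiff_maps m \<mu> \<nu> = {v. v < m \<and> \<mu> v \<noteq> \<nu> v}"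

definition nbhd :: "nat \<Rightarrow> nat set \<Rightarrow> nat set" where
  "nbhd m A = (\<Union>v\<in>A. {(v + m - 1) mod m, v, Suc v mod m})"

end

theory Submission
  imports Defs
begin

text \<open>Adjacency at \<open>p\<close> means that \<open>\<Lambda>(p\<^sub>1) + \<Lambda>(p\<^sub>2)\<close> is the value of \<open>\<Lambda>\<close> at exactly
  those vertices \<open>v\<close> with \<open>\<lambda>(v) = \<lambda>(p)\<close>, for both maps; with \<open>\<lambda>(p) = \<^bold>a\<close> this says that
  \<open>\<lambda>\<^sub>2\<close> differs from \<open>\<lambda>\<^sub>1\<close> only in the \<open>\<^bold>a\<close>-coordinate, and likewise \<open>\<lambda>\<^sub>3\<close> differs from
  \<open>\<lambda>\<^sub>1\<close> only in the \<open>\<^bold>b\<close>-coordinate.  In a realization of the square the vectors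
  \<open>\<Lambda>(p\<^sub>1), \<Lambda>(p\<^sub>2), \<Lambda>(q\<^sub>1), \<Lambda>(q\<^sub>2)\<close> form a basis, and the three projections
  force the coordinates of every other \<open>\<Lambda>(v)\<close>: the \<open>\<^bold>a\<close>-coordinates of \<open>\<lambda>\<^sub>1(v), \<lambda>\<^sub>2(v)\<close>
  and the \<open>\<^bold>b\<close>-coordinates of \<open>\<lambda>\<^sub>1(v), \<lambda>\<^sub>3(v)\<close>.  So the square is realizable iff this
  canonical \<open>\<Lambda>\<close> is characteristic, which fails exactly at a vertex, or an edge, away from
  \<open>p, q\<close> where the \<open>\<lambda>\<^sub>2\<close>-\<open>\<^bold>a\<close> and \<open>\<lambda>\<^sub>3\<close>-\<open>\<^bold>b\<close> coordinates vanish, or agree at both ends.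
  A check of the finitely many possible values identifies these obstructions with a vertex of
  \<open>\<lambda>\<^sub>1\<Delta>\<lambda>\<^sub>2\<close> lying in or next to \<open>\<lambda>\<^sub>1\<Delta>\<lambda>\<^sub>3\<close>, i.e.\ with the failure of (2); the same
  check excludes a vertex outside both sets adjacent to both, which gives (2) \<open>\<longleftrightarrow>\<close> (3).\<close>

section \<open>Vectors over \<open>\<int>\<^sub>2\<close>\<close>

lemma bit_vec_add_self [simp]: "(x::bit^'n) + x = 0"
  by (simp add: vec_eq_iff)

lemma bit_vec_add_eq_iff: "(x::bit^'n) + y = z \<longleftrightarrow> x = z + y"
  by (auto simp: add.assoc)

lemma bit_vec_add_eq_0_iff: "(x::bit^'n) + y = 0 \<longleftrightarrow> x = y"
  by (simp add: bit_vec_add_eq_iff)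

lemmas bit_eq_iff_even = Z2.bit_eq_iff even_zero odd_one

lemma vec2_eq_iff: "(x::'a^2) = y \<longleftrightarrow> x$1 = y$1 \<and> x$2 = y$2"
  by (simp add: vec_eq_iff forall_2)

text \<open>In the index type \<open>2\<close> the index \<open>0\<close> is \<open>2\<close>, so \<open>va\<close> is the second unit vector.\<close>

lemma va_vb_vc_nth [simp]:
  "va $ 1 = 0" "va $ 2 = 1" "vb $ 1 = 1" "vb $ 2 = 0" "vc $ 1 = 1" "vc $ 2 = 1"
  by (simp_all add: va_def vb_def vc_def)

lemma va_vb_vc_distinct [simp]: "va \<noteq> vb" "vb \<noteq> va" "va \<noteq> vc" "vc \<noteq> va" "vb \<noteq> vc" "vc \<noteq> vb"
  by (simp_all add: vec2_eq_iff)

lemma span_singleton_bit: "vec.span {u::bit^'n} = {0, u}"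
proof -
  have "range (\<lambda>k::bit. k *s u) = {0, u}"
    by (auto simp: image_iff) (metis vector_smult_lid)
  then show ?thesis by (simp add: vec.span_singleton)
qed

lemma span_pair: "vec.span {u, w::'a::field^'n} = {s *s u + t *s w | s t. True}"
  by (auto simp: vec.span_insert vec.span_singleton diff_eq_eq add.commute)

lemma linear_vecI:
  "(\<And>x y. f (x + y) = f x + f y) \<Longrightarrow> (\<And>c x. f (c *s x) = c *s f x) \<Longrightarrow>
   Vector_Spaces.linear (*s) (*s) (f :: 'a::field^'n \<Rightarrow> 'a^'m)"
  by (simp add: Vector_Spaces.linear_iff vec.vector_space_axioms)

lemma char_map_not_in_span:
  assumes "char_map K \<Lambda>" and "\<sigma> \<in> K" and "x \<in> \<sigma>"
  shows "\<Lambda> x \<notin> vec.span (\<Lambda> ` (\<sigma> - {x}))"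
proof
  assume in_span: "\<Lambda> x \<in> vec.span (\<Lambda> ` (\<sigma> - {x}))"
  have "inj_on \<Lambda> \<sigma>" and indep: "vec.independent (\<Lambda> ` \<sigma>)"
    using assms(1,2) unfolding char_map_def by auto
  then have "\<Lambda> ` (\<sigma> - {x}) = \<Lambda> ` \<sigma> - {\<Lambda> x}"
    using assms(3) by (auto simp: inj_on_def)
  then have "vec.dependent (\<Lambda> ` \<sigma>)"
    using in_span assms(3) unfolding vec.dependent_def by auto
  with indep show False by blast
qed

section \<open>The cycle \<open>P\<^sub>m\<close> and wedges\<close>

lemma mod_pred_eq_iff:
  assumes "v < m" and "w < (m::nat)"
  shows "(v + m - 1) mod m = w \<longleftrightarrow> Suc w mod m = v"
proof (cases v)
  case 0
  then show ?thesis using assms by (cases "Suc w = m") auto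
next
  case (Suc u)
  then have "(v + m - 1) mod m = u"
    using assms(1) by simp
  then show ?thesis using Suc assms by (cases "Suc w = m") auto
qed

definition cycle_adjacent :: "nat \<Rightarrow> nat \<Rightarrow> nat \<Rightarrow> bool" where
  "cycle_adjacent m v w \<longleftrightarrow> w = Suc v mod m \<or> v = Suc w mod m"

lemma cycle_adjacent_sym: "cycle_adjacent m v w \<longleftrightarrow> cycle_adjacent m w v"
  unfolding cycle_adjacent_def by blast

lemma mem_nbhd_iff:
  assumes "w < m" and "A \<subseteq> {..<m}"
  shows "w \<in> nbhd m A \<longleftrightarrow> (\<exists>v\<in>A. w = v \<or> cycle_adjacent m v w)"
proof -
  have "w = (v + m - 1) mod m \<longleftrightarrow> v = Suc w mod m" if "v \<in> A" for v
    using mod_pred_eq_iff[of v m w] that assms by auto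
  then show ?thesis unfolding nbhd_def cycle_adjacent_def by blast
qed

lemma nbhd_subset: "0 < m \<Longrightarrow> A \<subseteq> {..<m} \<Longrightarrow> nbhd m A \<subseteq> {..<m}"
  unfolding nbhd_def by auto

lemma subset_nbhd: "0 < m \<Longrightarrow> A \<subseteq> nbhd m A"
  unfolding nbhd_def by auto

lemma Pm_faces_downward: "S \<in> Pm_faces m \<Longrightarrow> T \<subseteq> S \<Longrightarrow> T \<in> Pm_faces m"
  unfolding Pm_faces_def by blast

definition wed_support :: "'v set \<Rightarrow> ('v \<times> nat) set \<Rightarrow> 'v set" where
  "wed_support W \<sigma> = {v. wed_lift W {v} \<subseteq> \<sigma>}"

lemma wed_lift_subset_iff: "wed_lift W N \<subseteq> \<sigma> \<longleftrightarrow> N \<subseteq> wed_support W \<sigma>"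
  unfolding wed_support_def wed_lift_def by blast

lemma mem_wed_lift_iff: "(v, k) \<in> wed_lift W S \<longleftrightarrow> v \<in> S \<and> (if v \<in> W then k \<in> {1, 2} else k = 0)"
  unfolding wed_lift_def by auto

lemma wed_lift_empty [simp]: "wed_lift W {} = {}"
  unfolding wed_lift_def by simp

lemma wed_lift_insert [simp]:
  "wed_lift W (insert v S) = (if v \<in> W then {(v, 1), (v, 2)} else {(v, 0)}) \<union> wed_lift W S"
  unfolding wed_lift_def by auto

lemma mem_wed_verts_iff:
  "(v, k) \<in> wed_verts V W \<longleftrightarrow> (if v \<in> W then k \<in> {1, 2} else v \<in> V \<and> k = 0)"
  unfolding wed_verts_def by auto

lemma mem_wed_support_iff:
  "v \<in> wed_support W \<sigma> \<longleftrightarrow> (if v \<in> W then (v, 1) \<in> \<sigma> \<and> (v, 2) \<in> \<sigma> else (v, 0) \<in> \<sigma>)"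
  unfolding wed_support_def wed_lift_def by auto

lemma wed_support_subset:
  assumes "\<sigma> \<subseteq> wed_verts V W" and "W \<subseteq> V"
  shows "wed_support W \<sigma> \<subseteq> V"
  using assms unfolding wed_support_def wed_lift_def wed_verts_def by auto

lemma no_min_nonface_subset_iff:
  assumes down: "\<And>S T. S \<in> K \<Longrightarrow> T \<subseteq> S \<Longrightarrow> T \<in> K"
    and "finite V" and "S \<subseteq> V"
  shows "(\<forall>N \<in> min_nonfaces V K. \<not> N \<subseteq> S) \<longleftrightarrow> S \<in> K"
proof
  assume no_min: "\<forall>N \<in> min_nonfaces V K. \<not> N \<subseteq> S"
  show "S \<in> K"
  proof (rule ccontr)
    assume "S \<notin> K"
    let ?B = "{N. N \<subseteq> S \<and> N \<notin> K}"
    have "finite ?B"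
      using finite_subset[OF assms(3,2)] by simp
    moreover have "?B \<noteq> {}"
      using \<open>S \<notin> K\<close> by blast
    ultimately obtain N where "N \<in> ?B" and minimal: "\<forall>T \<in> ?B. T \<subseteq> N \<longrightarrow> N = T"
      by (meson finite_has_minimal)
    then have "N \<in> min_nonfaces V K"
      using assms(3) unfolding min_nonfaces_def by blast
    with no_min \<open>N \<in> ?B\<close> show False by blast
  qed
next
  show "S \<in> K \<Longrightarrow> \<forall>N \<in> min_nonfaces V K. \<not> N \<subseteq> S"
    using down unfolding min_nonfaces_def by blast
qed

lemma mem_wed_iff:
  assumes "\<And>S T. S \<in> K \<Longrightarrow> T \<subseteq> S \<Longrightarrow> T \<in> K"
    and "finite V" and "W \<subseteq> V" and "\<sigma> \<subseteq> wed_verts V W"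
  shows "\<sigma> \<in> wed V W K \<longleftrightarrow> wed_support W \<sigma> \<in> K"
proof -
  have "\<sigma> \<in> wed V W K \<longleftrightarrow> (\<forall>N \<in> min_nonfaces V K. \<not> N \<subseteq> wed_support W \<sigma>)"
    using assms(4) unfolding wed_def wed_lift_subset_iff by simp
  also have "\<dots> \<longleftrightarrow> wed_support W \<sigma> \<in> K"
    by (rule no_min_nonface_subset_iff[OF assms(1,2) wed_support_subset[OF assms(4,3)]])
  finally show ?thesis .
qed

lemma wed_downward: "\<sigma> \<in> wed V W K \<Longrightarrow> \<tau> \<subseteq> \<sigma> \<Longrightarrow> \<tau> \<in> wed V W K"
  unfolding wed_def by blast

section \<open>Characteristic maps over \<open>P\<^sub>m\<close> and adjacency\<close>

lemma char_Pm_range: "char_Pm m l \<Longrightarrow> v < m \<Longrightarrow> l v \<in> {va, vb, vc}"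
  unfolding char_Pm_def by blast

lemma char_Pm_nonzero: "char_Pm m l \<Longrightarrow> v < m \<Longrightarrow> l v \<noteq> 0"
  using char_Pm_range[of m l v] by (auto simp: vec2_eq_iff)

lemma char_Pm_eq_va_iff: "char_Pm m l \<Longrightarrow> v < m \<Longrightarrow> l v = va \<longleftrightarrow> l v $ 1 = 0"
  using char_Pm_range[of m l v] by auto

lemma char_Pm_eq_vb_iff: "char_Pm m l \<Longrightarrow> v < m \<Longrightarrow> l v = vb \<longleftrightarrow> l v $ 2 = 0"
  using char_Pm_range[of m l v] by auto

lemma char_Pm_adjacent_neq:
  "char_Pm m l \<Longrightarrow> v < m \<Longrightarrow> w < m \<Longrightarrow> cycle_adjacent m v w \<Longrightarrow> l v \<noteq> l w"
  unfolding char_Pm_def cycle_adjacent_def by auto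

lemma proj_equivE:
  assumes "proj_equiv m \<Lambda> \<sigma> \<iota> l"
  obtains \<phi> :: "bit^'n \<Rightarrow> bit^2" where "Vector_Spaces.linear (*s) (*s) \<phi>"
    and "\<And>x. \<phi> x = 0 \<longleftrightarrow> x \<in> vec.span (\<Lambda> ` \<sigma>)"
    and "\<And>w. w < m \<Longrightarrow> \<phi> (\<Lambda> (\<iota> w)) = l w"
  using assms unfolding proj_equiv_def by blast

lemma p_adjacent_same_class:
  assumes adj: "p_adjacent m p l l'" and "p < m" and "char_Pm m l" and "char_Pm m l'"
    and v: "v < m"
  shows "l v = l p \<longleftrightarrow> l' v = l' p"
proof (cases "v = p")
  case False
  from adj obtain \<Lambda> :: "nat \<times> nat \<Rightarrow> bit^3" where
    "proj_equiv m \<Lambda> {(p, 2)} (wid {p} (\<lambda>_. 1)) l" and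
    "proj_equiv m \<Lambda> {(p, 1)} (wid {p} (\<lambda>_. 2)) l'"
    unfolding p_adjacent_def by blast
  then obtain \<phi> \<psi> :: "bit^3 \<Rightarrow> bit^2"
    where \<phi>: "Vector_Spaces.linear (*s) (*s) \<phi>" "\<And>x. \<phi> x = 0 \<longleftrightarrow> x \<in> {0, \<Lambda> (p, 2)}"
      "\<And>w. w < m \<Longrightarrow> \<phi> (\<Lambda> (wid {p} (\<lambda>_. 1) w)) = l w"
    and \<psi>: "Vector_Spaces.linear (*s) (*s) \<psi>" "\<And>x. \<psi> x = 0 \<longleftrightarrow> x \<in> {0, \<Lambda> (p, 1)}"
      "\<And>w. w < m \<Longrightarrow> \<psi> (\<Lambda> (wid {p} (\<lambda>_. 2) w)) = l' w"
    by (elim proj_equivE) (simp add: span_singleton_bit)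
  define u1 u2 x where "u1 = \<Lambda> (p, 1)" and "u2 = \<Lambda> (p, 2)" and "x = \<Lambda> (v, 0)"
  have \<phi>_values: "\<phi> x = l v" "\<phi> u1 = l p" "\<phi> u2 = 0"
    using \<phi>(2) \<phi>(3)[OF v] \<phi>(3)[OF \<open>p < m\<close>] False by (simp_all add: wid_def x_def u1_def u2_def)
  have \<psi>_values: "\<psi> x = l' v" "\<psi> u2 = l' p" "\<psi> u1 = 0"
    using \<psi>(2) \<psi>(3)[OF v] \<psi>(3)[OF \<open>p < m\<close>] False by (simp_all add: wid_def x_def u1_def u2_def)
  have "x \<noteq> u1" and "x \<noteq> u2"
    using \<phi>_values \<psi>_values char_Pm_nonzero[OF assms(3) v] char_Pm_nonzero[OF assms(4) v] by auto
  moreover have "l v = l p \<longleftrightarrow> x = u1 \<or> x = u2 + u1"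
  proof -
    have "l v = l p \<longleftrightarrow> \<phi> (x + u1) = 0"
      by (simp add: vec.linear_add[OF \<phi>(1)] \<phi>_values bit_vec_add_eq_0_iff)
    also have "\<dots> \<longleftrightarrow> x + u1 = 0 \<or> x + u1 = u2"
      unfolding \<phi>(2) u2_def by simp
    finally show ?thesis by (simp only: bit_vec_add_eq_0_iff bit_vec_add_eq_iff add_0_left)
  qed
  moreover have "l' v = l' p \<longleftrightarrow> x = u2 \<or> x = u1 + u2"
  proof -
    have "l' v = l' p \<longleftrightarrow> \<psi> (x + u2) = 0"
      by (simp add: vec.linear_add[OF \<psi>(1)] \<psi>_values bit_vec_add_eq_0_iff)
    also have "\<dots> \<longleftrightarrow> x + u2 = 0 \<or> x + u2 = u1"
      unfolding \<psi>(2) u1_def by simp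
    finally show ?thesis by (simp only: bit_vec_add_eq_0_iff bit_vec_add_eq_iff add_0_left)
  qed
  ultimately show ?thesis by (simp add: add.commute)
qed simp

lemma p_adjacent_nth_1_eq:
  assumes "p_adjacent m p l l'" and "p < m" and "char_Pm m l" and "char_Pm m l'"
    and "l p = va" and "l' p = va" and "v < m"
  shows "l' v $ 1 = l v $ 1"
  using p_adjacent_same_class[OF assms(1-4,7)] assms(5,6)
    char_Pm_eq_va_iff[OF assms(3,7)] char_Pm_eq_va_iff[OF assms(4,7)]
  by (cases "l v $ 1"; cases "l' v $ 1") auto

lemma p_adjacent_nth_2_eq:
  assumes "p_adjacent m p l l'" and "p < m" and "char_Pm m l" and "char_Pm m l'"
    and "l p = vb" and "l' p = vb" and "v < m"
  shows "l' v $ 2 = l v $ 2"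
  using p_adjacent_same_class[OF assms(1-4,7)] assms(5,6)
    char_Pm_eq_vb_iff[OF assms(3,7)] char_Pm_eq_vb_iff[OF assms(4,7)]
  by (cases "l v $ 2"; cases "l' v $ 2") auto

section \<open>Independence in \<open>\<int>\<^sub>2\<^sup>4\<close>\<close>

lemma axis_nth_bit: "axis i (1::bit) $ j = (if j = i then 1 else 0)"
  by (simp add: axis_def)

lemma distinct_4_eq_UNIV:
  fixes a b c d :: 4
  assumes "distinct [a, b, c, d]"
  shows "{a, b, c, d} = UNIV"
proof (rule card_eq_UNIV_imp_eq_UNIV)
  show "card {a, b, c, d} = card (UNIV :: 4 set)"
    using distinct_card[OF assms] by simp
qed simp

lemma independent_4I:
  fixes a b c d :: "'a::field^'n"
  assumes "distinct [a, b, c, d]"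
    and "\<And>k1 k2 k3 k4. k1 *s a + k2 *s b + k3 *s c + k4 *s d = 0 \<Longrightarrow>
           k1 = 0 \<and> k2 = 0 \<and> k3 = 0 \<and> k4 = 0"
  shows "vec.independent {a, b, c, d}"
proof
  assume "vec.dependent {a, b, c, d}"
  then obtain u where u: "\<exists>v\<in>{a, b, c, d}. u v \<noteq> 0" "(\<Sum>v\<in>{a, b, c, d}. u v *s v) = 0"
    using vec.dependent_finite[of "{a, b, c, d}"] by auto
  have "u a *s a + u b *s b + u c *s c + u d *s d = 0"
    using u(2) assms(1) by (simp add: add.assoc)
  then have "u a = 0 \<and> u b = 0 \<and> u c = 0 \<and> u d = 0"
    by (rule assms(2))
  with u(1) show False
    by simp
qed

lemma bit_add_eq_0_iff: "(a::bit) + b = 0 \<longleftrightarrow> a = b"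
  by (cases a; cases b) simp_all

lemma independent_two_axes:
  fixes x y :: "bit^4"
  assumes "distinct [j1, j2, j3, j4]"
    and "x$j3 \<noteq> 0 \<or> x$j4 \<noteq> 0" "y$j3 \<noteq> 0 \<or> y$j4 \<noteq> 0" "x$j3 \<noteq> y$j3 \<or> x$j4 \<noteq> y$j4"
  shows "distinct [axis j1 1, axis j2 1, x, y] \<and> vec.independent {axis j1 1, axis j2 1, x, y}"
proof
  have "axis j (1::bit) \<noteq> z" if "j \<in> {j1, j2}" "z$j3 \<noteq> 0 \<or> z$j4 \<noteq> 0" for j z
    using that assms(1) by (auto simp: axis_nth_bit)
  moreover have "axis j1 (1::bit) \<noteq> axis j2 1"
    using assms(1) by (auto simp: vec_eq_iff axis_nth_bit)
  ultimately show distinct: "distinct [axis j1 1, axis j2 1, x, y]"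
    using assms(2-4) by auto
  show "vec.independent {axis j1 1, axis j2 1, x, y}"
  proof (rule independent_4I[OF distinct])
    fix k1 k2 k3 k4 :: bit
    assume "k1 *s axis j1 1 + k2 *s axis j2 1 + k3 *s x + k4 *s y = 0"
    then have coord: "k1 * axis j1 1 $ j + k2 * axis j2 1 $ j + k3 * x $ j + k4 * y $ j = 0" for j
      by (simp add: vec_eq_iff del: add_bit_eq_xor mult_bit_eq_and)
    have "k3 = 0 \<and> k4 = 0"
      using coord[of j3] coord[of j4] assms
      by (cases k3; cases k4)
        (auto simp: axis_nth_bit bit_add_eq_0_iff simp del: add_bit_eq_xor mult_bit_eq_and)
    with coord[of j1] coord[of j2] show "k1 = 0 \<and> k2 = 0 \<and> k3 = 0 \<and> k4 = 0"
      using assms(1) by (auto simp: axis_nth_bit simp del: add_bit_eq_xor mult_bit_eq_and)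
  qed
qed

lemma independent_three_axes:
  fixes x :: "bit^4"
  assumes "distinct [j1, j2, j3, j4]" and "x$j4 \<noteq> 0"
  shows "distinct [axis j1 1, axis j2 1, axis j3 1, x] \<and>
    vec.independent {axis j1 1, axis j2 1, axis j3 1, x}"
proof
  have "axis j (1::bit) \<noteq> x" if "j \<in> {j1, j2, j3}" for j
    using that assms by (auto simp: axis_nth_bit)
  moreover have "axis i (1::bit) \<noteq> axis j 1" if "i \<noteq> j" for i j
    using that by (auto simp: vec_eq_iff axis_nth_bit)
  ultimately show distinct: "distinct [axis j1 1, axis j2 1, axis j3 1, x]"
    using assms(1) by auto
  show "vec.independent {axis j1 1, axis j2 1, axis j3 1, x}"
  proof (rule independent_4I[OF distinct])
    fix k1 k2 k3 k4 :: bit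
    assume "k1 *s axis j1 1 + k2 *s axis j2 1 + k3 *s axis j3 1 + k4 *s x = 0"
    then have coord: "k1 * axis j1 1 $ j + k2 * axis j2 1 $ j + k3 * axis j3 1 $ j + k4 * x $ j = 0"
      for j
      by (simp add: vec_eq_iff del: add_bit_eq_xor mult_bit_eq_and)
    have "k4 = 0"
      using coord[of j4] assms
      by (cases k4) (auto simp: axis_nth_bit simp del: add_bit_eq_xor mult_bit_eq_and)
    with coord[of j1] coord[of j2] coord[of j3] show "k1 = 0 \<and> k2 = 0 \<and> k3 = 0 \<and> k4 = 0"
      using assms(1) by (auto simp: axis_nth_bit simp del: add_bit_eq_xor mult_bit_eq_and)
  qed
qed

lemma inj_on_independent_image_4:
  "distinct [f a, f b, f c, f d] \<Longrightarrow> vec.independent {f a, f b, f c, f d} \<Longrightarrow>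
   inj_on f {a, b, c, d} \<and> vec.independent (f ` {a, b, c, d})"
  by auto

definition coord_proj :: "4 \<Rightarrow> 4 \<Rightarrow> bit^4 \<Rightarrow> bit^2" where
  "coord_proj a b x = (\<chi> i. if i = 1 then x $ b else x $ a)"

lemma coord_proj_nth [simp]: "coord_proj a b x $ 1 = x $ b" "coord_proj a b x $ 2 = x $ a"
  by (simp_all add: coord_proj_def)

lemma proj_equiv_coord_projI:
  fixes \<Lambda> :: "'v \<Rightarrow> bit^4"
  assumes distinct: "distinct [a, b, c, d]" and kernel: "\<Lambda> ` \<sigma> = {axis c 1, axis d 1}"
    and images: "\<And>w. w < m \<Longrightarrow> coord_proj a b (\<Lambda> (\<iota> w)) = l w"
  shows "proj_equiv m \<Lambda> \<sigma> \<iota> l"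
  unfolding proj_equiv_def
proof (intro exI conjI)
  show "Vector_Spaces.linear (*s) (*s) (coord_proj a b)"
    by (rule linear_vecI) (simp_all add: vec2_eq_iff)
  have "y = coord_proj a b (y$2 *s axis a 1 + y$1 *s axis b 1)" for y
    using distinct by (auto simp: vec2_eq_iff axis_nth_bit)
  then show "surj (coord_proj a b)"
    unfolding surj_def by blast
  have "x \<in> vec.span {axis c 1, axis d 1} \<longleftrightarrow> x$a = 0 \<and> x$b = 0" for x :: "bit^4"
  proof
    assume "x \<in> vec.span {axis c 1, axis d 1}"
    then obtain s t where "x = s *s axis c 1 + t *s axis d 1"
      unfolding span_pair by blast
    then show "x$a = 0 \<and> x$b = 0"
      using distinct by (simp add: axis_nth_bit)
  next
    assume "x$a = 0 \<and> x$b = 0"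
    then have "x = x$c *s axis c 1 + x$d *s axis d 1"
      using distinct distinct_4_eq_UNIV[OF distinct]
      by (auto simp: vec_eq_iff axis_nth_bit simp del: add_bit_eq_xor mult_bit_eq_and)
    then show "x \<in> vec.span {axis c 1, axis d 1}"
      unfolding span_pair by blast
  qed
  then show "{x. coord_proj a b x = 0} = vec.span (\<Lambda> ` \<sigma>)"
    unfolding kernel by (auto simp: vec2_eq_iff)
qed (use images in auto)

section \<open>The square\<close>

text \<open>For the vertex vectors below, the coordinate pairs \<open>(1,3)\<close>, \<open>(2,3)\<close>, \<open>(1,4)\<close> are the
  values of \<open>\<lambda>\<^sub>1\<close>, \<open>\<lambda>\<^sub>2\<close>, \<open>\<lambda>\<^sub>3\<close>; admissibility and compatibility say that these values are
  nonzero and differ along edges.\<close>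

definition admissible_bits :: "bit^4 \<Rightarrow> bool" where
  "admissible_bits x \<longleftrightarrow> (x$1 \<noteq> 0 \<or> x$3 \<noteq> 0) \<and> (x$2 \<noteq> 0 \<or> x$3 \<noteq> 0) \<and> (x$1 \<noteq> 0 \<or> x$4 \<noteq> 0)"

definition compatible_bits :: "bit^4 \<Rightarrow> bit^4 \<Rightarrow> bool" where
  "compatible_bits x y \<longleftrightarrow>
     (x$1 \<noteq> y$1 \<or> x$3 \<noteq> y$3) \<and> (x$2 \<noteq> y$2 \<or> x$3 \<noteq> y$3) \<and> (x$1 \<noteq> y$1 \<or> x$4 \<noteq> y$4)"

lemma compatible_bits_sym: "compatible_bits x y \<longleftrightarrow> compatible_bits y x"
  unfolding compatible_bits_def by auto

text \<open>The next four lemmas are finite checks; rewriting every bit equation as an equation of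
  parities turns them into propositional tautologies.\<close>

lemma admissible_bits_diff_iff:
  "admissible_bits x \<Longrightarrow> x$1 \<noteq> x$2 \<and> x$3 \<noteq> x$4 \<longleftrightarrow> x$2 = 0 \<and> x$4 = 0"
  unfolding admissible_bits_def bit_eq_iff_even by argo

lemma compatible_bits_equal_imp_cross_diff:
  assumes "admissible_bits x" "admissible_bits y" "compatible_bits x y"
    and "x$2 = y$2" "x$4 = y$4"
  shows "(x$1 \<noteq> x$2 \<and> y$3 \<noteq> y$4) \<or> (y$1 \<noteq> y$2 \<and> x$3 \<noteq> x$4)"
  using assms unfolding admissible_bits_def compatible_bits_def bit_eq_iff_even by argo

lemma compatible_bits_cross_diff_imp:
  assumes "admissible_bits x" "admissible_bits y" "compatible_bits x y"
    and "x$1 \<noteq> x$2" "y$3 \<noteq> y$4"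
  shows "(x$2 = y$2 \<and> x$4 = y$4) \<or> (x$2 = 0 \<and> x$4 = 0) \<or> (y$2 = 0 \<and> y$4 = 0)"
  using assms unfolding admissible_bits_def compatible_bits_def bit_eq_iff_even by argo

lemma compatible_bits_no_diff_path:
  assumes "admissible_bits x" "admissible_bits y" "admissible_bits z"
    and "compatible_bits x y" "compatible_bits y z"
    and "x$1 \<noteq> x$2" "y$1 = y$2" "y$3 = y$4" "z$3 \<noteq> z$4"
  shows False
  using assms unfolding admissible_bits_def compatible_bits_def bit_eq_iff_even by argo

locale adjacent_square =
  fixes m p q :: nat and l1 l2 l3 :: "nat \<Rightarrow> bit^2"
  assumes m: "m \<ge> 3" and p: "p < m" and q: "q < m" and pq: "p \<noteq> q"
    and char: "char_Pm m l1" "char_Pm m l2" "char_Pm m l3"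
    and at_p: "l1 p = va" "l2 p = va" "l3 p = va"
    and at_q: "l1 q = vb" "l2 q = vb" "l3 q = vb"
    and l2_nth_1: "\<And>v. v < m \<Longrightarrow> l2 v $ 1 = l1 v $ 1"
    and l3_nth_2: "\<And>v. v < m \<Longrightarrow> l3 v $ 2 = l1 v $ 2"
begin

text \<open>The coordinates of \<open>\<Lambda>(v)\<close> in the basis \<open>\<Lambda>(p\<^sub>1), \<Lambda>(p\<^sub>2), \<Lambda>(q\<^sub>1), \<Lambda>(q\<^sub>2)\<close> of any
  realization of the square, by \<open>realizes_vertex_eq\<close>.\<close>

definition vertex_vector :: "nat \<Rightarrow> bit^4" where
  "vertex_vector v = (\<chi> i. if i = 1 then l1 v $ 2 else if i = 2 then l2 v $ 2
                             else if i = 3 then l1 v $ 1 else l3 v $ 1)"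

lemma vertex_vector_nth [simp]:
  "vertex_vector v $ 1 = l1 v $ 2" "vertex_vector v $ 2 = l2 v $ 2"
  "vertex_vector v $ 3 = l1 v $ 1" "vertex_vector v $ 4 = l3 v $ 1"
  by (simp_all add: vertex_vector_def)

lemma vertex_vector_admissible: "v < m \<Longrightarrow> admissible_bits (vertex_vector v)"
  using char_Pm_nonzero[OF char(1)] char_Pm_nonzero[OF char(2)] char_Pm_nonzero[OF char(3)]
    l2_nth_1 l3_nth_2
  unfolding admissible_bits_def by (simp add: vec2_eq_iff) metis

lemma vertex_vector_compatible:
  assumes "v < m" "w < m" "cycle_adjacent m v w"
  shows "compatible_bits (vertex_vector v) (vertex_vector w)"
  using char_Pm_adjacent_neq[OF char(1) assms] char_Pm_adjacent_neq[OF char(2) assms]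
    char_Pm_adjacent_neq[OF char(3) assms] l2_nth_1[OF assms(1)] l2_nth_1[OF assms(2)]
    l3_nth_2[OF assms(1)] l3_nth_2[OF assms(2)]
  unfolding compatible_bits_def by (simp add: vec2_eq_iff) blast

lemma sdiff_12_eq: "sdiff_maps m l1 l2 = {v. v < m \<and> vertex_vector v $ 1 \<noteq> vertex_vector v $ 2}"
  unfolding sdiff_maps_def using l2_nth_1 by (auto simp: vec2_eq_iff)

lemma sdiff_13_eq: "sdiff_maps m l1 l3 = {v. v < m \<and> vertex_vector v $ 3 \<noteq> vertex_vector v $ 4}"
  unfolding sdiff_maps_def using l3_nth_2 by (auto simp: vec2_eq_iff)

definition degenerate_vertex :: "nat \<Rightarrow> bool" where
  "degenerate_vertex v \<longleftrightarrow> v < m \<and> v \<notin> {p, q} \<and>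
     vertex_vector v $ 2 = 0 \<and> vertex_vector v $ 4 = 0"

definition degenerate_edge :: "nat \<Rightarrow> bool" where
  "degenerate_edge v \<longleftrightarrow> v < m \<and> v \<notin> {p, q} \<and> Suc v mod m \<notin> {p, q} \<and>
     vertex_vector v $ 2 = vertex_vector (Suc v mod m) $ 2 \<and>
     vertex_vector v $ 4 = vertex_vector (Suc v mod m) $ 4"

definition degenerate :: bool where
  "degenerate \<longleftrightarrow> (\<exists>v. degenerate_vertex v \<or> degenerate_edge v)"

lemma nbhd_sdiff_disjoint_iff:
  "nbhd m (sdiff_maps m l1 l2) \<inter> sdiff_maps m l1 l3 = {} \<longleftrightarrow>
   \<not> (\<exists>v \<in> sdiff_maps m l1 l2. \<exists>w \<in> sdiff_maps m l1 l3. w = v \<or> cycle_adjacent m v w)"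
  using mem_nbhd_iff[of _ m "sdiff_maps m l1 l2"] unfolding sdiff_maps_def by auto

lemma sdiff_avoids_p_q: "v \<in> sdiff_maps m l1 l2 \<union> sdiff_maps m l1 l3 \<Longrightarrow> v \<notin> {p, q}"
  unfolding sdiff_12_eq sdiff_13_eq using at_p at_q by auto

lemma close_sdiffs_iff_degenerate:
  "(\<exists>v \<in> sdiff_maps m l1 l2. \<exists>w \<in> sdiff_maps m l1 l3. w = v \<or> cycle_adjacent m v w)
   \<longleftrightarrow> degenerate"
proof
  assume "\<exists>v \<in> sdiff_maps m l1 l2. \<exists>w \<in> sdiff_maps m l1 l3. w = v \<or> cycle_adjacent m v w"
  then obtain v w where v: "v \<in> sdiff_maps m l1 l2" and w: "w \<in> sdiff_maps m l1 l3"
    and close: "w = v \<or> cycle_adjacent m v w"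
    by blast
  have "v < m" "w < m" "v \<notin> {p, q}" "w \<notin> {p, q}"
    using v w sdiff_avoids_p_q unfolding sdiff_maps_def by auto
  show degenerate
  proof (cases "w = v")
    case True
    then show ?thesis
      using v w admissible_bits_diff_iff[OF vertex_vector_admissible[OF \<open>v < m\<close>]]
        \<open>v < m\<close> \<open>v \<notin> {p, q}\<close>
      unfolding sdiff_12_eq sdiff_13_eq degenerate_def degenerate_vertex_def by auto
  next
    case False
    with close have adj: "cycle_adjacent m v w" by blast
    have "(vertex_vector v $ 2 = vertex_vector w $ 2 \<and> vertex_vector v $ 4 = vertex_vector w $ 4)
        \<or> degenerate_vertex v \<or> degenerate_vertex w"
      using compatible_bits_cross_diff_imp[OF vertex_vector_admissible vertex_vector_admissible
          vertex_vector_compatible[OF \<open>v < m\<close> \<open>w < m\<close> adj]] v w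
        \<open>v < m\<close> \<open>w < m\<close> \<open>v \<notin> {p, q}\<close> \<open>w \<notin> {p, q}\<close>
      unfolding sdiff_12_eq sdiff_13_eq degenerate_vertex_def by auto
    then show ?thesis
      using adj \<open>v \<notin> {p, q}\<close> \<open>w \<notin> {p, q}\<close> \<open>v < m\<close> \<open>w < m\<close>
      unfolding degenerate_def degenerate_edge_def cycle_adjacent_def by auto
  qed
next
  assume degenerate
  then consider v where "degenerate_vertex v" | v where "degenerate_edge v"
    unfolding degenerate_def by blast
  then show "\<exists>v \<in> sdiff_maps m l1 l2. \<exists>w \<in> sdiff_maps m l1 l3. w = v \<or> cycle_adjacent m v w"
  proof cases
    case 1
    then show ?thesis
      using admissible_bits_diff_iff[OF vertex_vector_admissible]
      unfolding degenerate_vertex_def sdiff_12_eq sdiff_13_eq by blast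
  next
    case 2
    define w where "w = Suc v mod m"
    have "v < m" "w < m" "cycle_adjacent m v w"
      using 2 m unfolding degenerate_edge_def w_def cycle_adjacent_def by auto
    moreover have "vertex_vector v $ 2 = vertex_vector w $ 2"
      "vertex_vector v $ 4 = vertex_vector w $ 4"
      using 2 unfolding degenerate_edge_def w_def by auto
    ultimately show ?thesis
      using compatible_bits_equal_imp_cross_diff[OF vertex_vector_admissible
          vertex_vector_admissible vertex_vector_compatible]
        cycle_adjacent_sym[of m v w]
      unfolding sdiff_12_eq sdiff_13_eq by blast
  qed
qed

lemma nbhd_sdiffs_disjoint_iff:
  "nbhd m (sdiff_maps m l1 l2) \<inter> sdiff_maps m l1 l3 = {} \<longleftrightarrow>
   nbhd m (sdiff_maps m l1 l2) \<inter> nbhd m (sdiff_maps m l1 l3) = {}"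
proof
  assume far: "nbhd m (sdiff_maps m l1 l2) \<inter> sdiff_maps m l1 l3 = {}"
  show "nbhd m (sdiff_maps m l1 l2) \<inter> nbhd m (sdiff_maps m l1 l3) = {}"
  proof (rule ccontr)
    assume "nbhd m (sdiff_maps m l1 l2) \<inter> nbhd m (sdiff_maps m l1 l3) \<noteq> {}"
    then obtain x where x12: "x \<in> nbhd m (sdiff_maps m l1 l2)"
      and x13: "x \<in> nbhd m (sdiff_maps m l1 l3)"
      by blast
    have sub: "sdiff_maps m l1 l2 \<subseteq> {..<m}" "sdiff_maps m l1 l3 \<subseteq> {..<m}"
      unfolding sdiff_maps_def by auto
    have "x < m"
      using x12 nbhd_subset[OF _ sub(1)] m by auto
    obtain v where v: "v \<in> sdiff_maps m l1 l2" and "x = v \<or> cycle_adjacent m v x"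
      using x12 mem_nbhd_iff[OF \<open>x < m\<close> sub(1)] by blast
    moreover obtain w where w: "w \<in> sdiff_maps m l1 l3" and "x = w \<or> cycle_adjacent m w x"
      using x13 mem_nbhd_iff[OF \<open>x < m\<close> sub(2)] by blast
    moreover note not_close = far[unfolded nbhd_sdiff_disjoint_iff]
    ultimately have "cycle_adjacent m v x" "cycle_adjacent m x w"
      "x \<notin> sdiff_maps m l1 l2" "x \<notin> sdiff_maps m l1 l3"
      using w cycle_adjacent_sym by metis+
    then show False
      using compatible_bits_no_diff_path[OF vertex_vector_admissible vertex_vector_admissible
          vertex_vector_admissible vertex_vector_compatible vertex_vector_compatible]
        v w \<open>x < m\<close>
      unfolding sdiff_12_eq sdiff_13_eq by blast
  qed
qed (use subset_nbhd[of m "sdiff_maps m l1 l3"] m in auto)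

abbreviation wed_pq :: "(nat \<times> nat) set set" where
  "wed_pq \<equiv> wed {0..<m} {p, q} (Pm_faces m)"

text \<open>The facets of \<open>wed\<^sub>p\<^sub>,\<^sub>q P\<^sub>m\<close>: the lift of an edge, completed by one copy of each of
  \<open>p\<close> and \<open>q\<close> (absorbed by the lift when the edge contains them).\<close>

definition wed_facet :: "nat \<Rightarrow> nat \<Rightarrow> nat \<Rightarrow> (nat \<times> nat) set" where
  "wed_facet i kp kq = wed_lift {p, q} {i, Suc i mod m} \<union> {(p, kp), (q, kq)}"

lemma mem_wed_pq_iff:
  "\<sigma> \<subseteq> wed_verts {0..<m} {p, q} \<Longrightarrow> \<sigma> \<in> wed_pq \<longleftrightarrow> wed_support {p, q} \<sigma> \<in> Pm_faces m"
  by (rule mem_wed_iff) (use Pm_faces_downward p q in auto)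

lemma wed_facet_mem:
  assumes "i < m" and "kp \<in> {1, 2}" and "kq \<in> {1, 2}"
  shows "wed_facet i kp kq \<in> wed_pq"
proof -
  have verts: "wed_facet i kp kq \<subseteq> wed_verts {0..<m} {p, q}"
    using assms p q m unfolding wed_facet_def by (auto simp: mem_wed_lift_iff mem_wed_verts_iff)
  have "wed_support {p, q} (wed_facet i kp kq) \<subseteq> {i, Suc i mod m}"
    using assms pq
    unfolding wed_facet_def by (auto simp: mem_wed_support_iff mem_wed_lift_iff split: if_splits)
  then have "wed_support {p, q} (wed_facet i kp kq) \<in> Pm_faces m"
    using \<open>i < m\<close> unfolding Pm_faces_def by blast
  with verts show ?thesis
    using mem_wed_pq_iff by blast
qed

lemma wed_pq_face_subset_facet:
  assumes "\<sigma> \<in> wed_pq"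
  obtains i kp kq where "i < m" "kp \<in> {1, 2}" "kq \<in> {1, 2}" "\<sigma> \<subseteq> wed_facet i kp kq"
proof -
  have verts: "\<sigma> \<subseteq> wed_verts {0..<m} {p, q}"
    using assms unfolding wed_def by blast
  then obtain i where "i < m" and support: "wed_support {p, q} \<sigma> \<subseteq> {i, Suc i mod m}"
    using assms mem_wed_pq_iff unfolding Pm_faces_def by blast
  define kp where "kp = (if (p, 1) \<in> \<sigma> then 1 else 2 :: nat)"
  define kq where "kq = (if (q, 1) \<in> \<sigma> then 1 else 2 :: nat)"
  have "(v, k) \<in> wed_facet i kp kq" if "(v, k) \<in> \<sigma>" for v k
  proof (cases "v \<in> {p, q}")
    case True
    then have "k \<in> {1, 2}"
      using verts that by (auto simp: mem_wed_verts_iff)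
    then show ?thesis
      using True that support pq mem_wed_support_iff[of v "{p, q}" \<sigma>]
      unfolding wed_facet_def kp_def kq_def by (auto simp: mem_wed_lift_iff)
  next
    case False
    then show ?thesis
      using that verts support mem_wed_support_iff[of v "{p, q}" \<sigma>]
      unfolding wed_facet_def by (auto simp: mem_wed_lift_iff mem_wed_verts_iff)
  qed
  then have "\<sigma> \<subseteq> wed_facet i kp kq"
    by auto
  moreover have "kp \<in> {1, 2}" "kq \<in> {1, 2}"
    unfolding kp_def kq_def by auto
  ultimately show ?thesis
    using that \<open>i < m\<close> by blast
qed

definition realizes :: "(nat \<times> nat \<Rightarrow> bit^4) \<Rightarrow> bool" where
  "realizes \<Lambda> \<longleftrightarrow> char_map wed_pq \<Lambda> \<and>
     proj_equiv m \<Lambda> {(p, 2), (q, 2)} (wid {p, q} (\<lambda>_. 1)) l1 \<and>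
     proj_equiv m \<Lambda> {(p, 1), (q, 2)} (wid {p, q} (\<lambda>v. if v = p then 2 else 1)) l2 \<and>
     proj_equiv m \<Lambda> {(p, 2), (q, 1)} (wid {p, q} (\<lambda>v. if v = p then 1 else 2)) l3"

lemma realizes_vertex_eq:
  assumes "realizes \<Lambda>" and v: "v < m" "v \<notin> {p, q}"
  shows "\<Lambda> (v, 0) = vertex_vector v $ 1 *s \<Lambda> (p, 1) + vertex_vector v $ 2 *s \<Lambda> (p, 2)
                  + vertex_vector v $ 3 *s \<Lambda> (q, 1) + vertex_vector v $ 4 *s \<Lambda> (q, 2)"
proof -
  obtain \<phi>1 \<phi>2 \<phi>3 :: "bit^4 \<Rightarrow> bit^2"
    where \<phi>1: "Vector_Spaces.linear (*s) (*s) \<phi>1"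
      "\<And>x. \<phi>1 x = 0 \<longleftrightarrow> x \<in> vec.span {\<Lambda> (p, 2), \<Lambda> (q, 2)}"
      "\<And>w. w < m \<Longrightarrow> \<phi>1 (\<Lambda> (wid {p, q} (\<lambda>_. 1) w)) = l1 w"
    and \<phi>2: "Vector_Spaces.linear (*s) (*s) \<phi>2"
      "\<And>x. \<phi>2 x = 0 \<longleftrightarrow> x \<in> vec.span {\<Lambda> (p, 1), \<Lambda> (q, 2)}"
      "\<And>w. w < m \<Longrightarrow> \<phi>2 (\<Lambda> (wid {p, q} (\<lambda>v. if v = p then 2 else 1) w)) = l2 w"
    and \<phi>3: "Vector_Spaces.linear (*s) (*s) \<phi>3"
      "\<And>x. \<phi>3 x = 0 \<longleftrightarrow> x \<in> vec.span {\<Lambda> (p, 2), \<Lambda> (q, 1)}"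
      "\<And>w. w < m \<Longrightarrow> \<phi>3 (\<Lambda> (wid {p, q} (\<lambda>v. if v = p then 1 else 2) w)) = l3 w"
    using assms(1) unfolding realizes_def by (auto elim!: proj_equivE)
  have vertex: "\<And>f. wid {p, q} f v = (v, 0)"
    using v by (simp add: wid_def)
  have at_p_q: "\<And>f. wid {p, q} f p = (p, f p)" "\<And>f. wid {p, q} f q = (q, f q)"
    by (simp_all add: wid_def)
  note images = \<phi>1(3)[OF v(1)] \<phi>2(3)[OF v(1)] \<phi>3(3)[OF v(1)]
    \<phi>1(3)[OF p] \<phi>2(3)[OF p] \<phi>3(3)[OF p] \<phi>1(3)[OF q] \<phi>2(3)[OF q] \<phi>3(3)[OF q]
  have kernels: "\<phi>1 (\<Lambda> (p, 2)) = 0" "\<phi>1 (\<Lambda> (q, 2)) = 0" "\<phi>2 (\<Lambda> (p, 1)) = 0"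
    "\<phi>2 (\<Lambda> (q, 2)) = 0" "\<phi>3 (\<Lambda> (p, 2)) = 0" "\<phi>3 (\<Lambda> (q, 1)) = 0"
    using \<phi>1(2) \<phi>2(2) \<phi>3(2) by (auto intro: vec.span_base)
  txt \<open>\<open>\<phi>\<^sub>1\<close> kills \<open>\<Lambda>(p\<^sub>2), \<Lambda>(q\<^sub>2)\<close> and sends \<open>\<Lambda>(p\<^sub>1), \<Lambda>(q\<^sub>1)\<close> to \<open>\<^bold>a, \<^bold>b\<close>, which
    fixes the first and third coordinates; \<open>\<phi>\<^sub>2\<close> and \<open>\<phi>\<^sub>3\<close> then read off the other two.\<close>
  define x where "x = \<Lambda> (v, 0)"
  define y where "y = vertex_vector v $ 1 *s \<Lambda> (p, 1) + vertex_vector v $ 3 *s \<Lambda> (q, 1)"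
  have "\<phi>1 (x + y) = 0"
    using images kernels at_p_q pq at_p at_q
    by (simp add: x_def y_def vertex vec.linear_add[OF \<phi>1(1)] vec.linear_scale[OF \<phi>1(1)]
        vec2_eq_iff)
  then obtain s t where "x + y = s *s \<Lambda> (p, 2) + t *s \<Lambda> (q, 2)"
    using \<phi>1(2) span_pair by blast
  then have x_eq: "x = s *s \<Lambda> (p, 2) + t *s \<Lambda> (q, 2) + y"
    by (simp add: bit_vec_add_eq_iff)
  have "l2 v = s *s va + vertex_vector v $ 3 *s vb"
    using images kernels at_p_q pq at_p at_q l2_nth_1[OF v(1)]
    by (simp add: x_eq[unfolded x_def] y_def vertex vec.linear_add[OF \<phi>2(1)]
        vec.linear_scale[OF \<phi>2(1)])
  then have s: "s = vertex_vector v $ 2"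
    by simp
  have "l3 v = t *s vb + vertex_vector v $ 1 *s va"
    using images kernels at_p_q pq at_p at_q l3_nth_2[OF v(1)]
    by (simp add: x_eq[unfolded x_def] y_def vertex vec.linear_add[OF \<phi>3(1)]
        vec.linear_scale[OF \<phi>3(1)] add.commute)
  then have t: "t = vertex_vector v $ 4"
    by simp
  show ?thesis
    using x_eq s t unfolding x_def y_def by (simp add: add_ac)
qed

lemma realizes_imp_not_degenerate:
  assumes "realizes \<Lambda>"
  shows "\<not> degenerate"
proof
  assume degenerate
  have char_map: "char_map wed_pq \<Lambda>"
    using assms unfolding realizes_def by blast
  have facet: "wed_facet v 1 1 \<in> wed_pq" if "v < m" for v
    using wed_facet_mem[OF that] by simp
  from \<open>degenerate\<close> consider v where "degenerate_vertex v" | v where "degenerate_edge v"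
    unfolding degenerate_def by blast
  then show False
  proof cases
    case 1
    then have v: "v < m" "v \<notin> {p, q}" and X: "vertex_vector v $ 2 = 0" "vertex_vector v $ 4 = 0"
      unfolding degenerate_vertex_def by auto
    let ?\<sigma> = "{(p, 1), (q, 1), (v, 0)}"
    have "?\<sigma> \<subseteq> wed_facet v 1 1"
      using v unfolding wed_facet_def by (auto simp: mem_wed_lift_iff)
    then have face: "?\<sigma> \<in> wed_pq"
      using wed_downward facet[OF v(1)] by blast
    have "\<Lambda> ` (?\<sigma> - {(v, 0)}) = {\<Lambda> (p, 1), \<Lambda> (q, 1)}"
      using v by auto
    then have "\<Lambda> (v, 0) \<in> vec.span (\<Lambda> ` (?\<sigma> - {(v, 0)}))"
      using realizes_vertex_eq[OF assms v] X
      by (simp add: vec.span_add vec.span_scale vec.span_base)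
    with face show False
      using char_map_not_in_span[OF char_map] by blast
  next
    case 2
    define w where "w = Suc v mod m"
    have v: "v < m" "v \<notin> {p, q}" and "w \<notin> {p, q}"
      and X: "vertex_vector v $ 2 = vertex_vector w $ 2" "vertex_vector v $ 4 = vertex_vector w $ 4"
      using 2 unfolding degenerate_edge_def w_def by auto
    moreover have "w < m"
      using m by (simp add: w_def)
    moreover have "w \<noteq> v"
      using m v(1) unfolding w_def by (cases "Suc v = m") auto
    ultimately have w: "w < m" "w \<notin> {p, q}" "w \<noteq> v"
      by blast+
    let ?\<sigma> = "{(p, 1), (q, 1), (v, 0), (w, 0)}"
    have "?\<sigma> \<subseteq> wed_facet v 1 1"
      using v w unfolding wed_facet_def w_def by (auto simp: mem_wed_lift_iff)
    then have face: "?\<sigma> \<in> wed_pq"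
      using wed_downward facet[OF v(1)] by blast
    have difference: "\<Lambda> (v, 0) = \<Lambda> (w, 0) + (vertex_vector v $ 1 - vertex_vector w $ 1) *s \<Lambda> (p, 1)
        + (vertex_vector v $ 3 - vertex_vector w $ 3) *s \<Lambda> (q, 1)"
      unfolding realizes_vertex_eq[OF assms v] realizes_vertex_eq[OF assms w(1,2)] X
        vec.scale_left_diff_distrib
      by (simp add: algebra_simps)
    have "\<Lambda> ` (?\<sigma> - {(v, 0)}) = {\<Lambda> (p, 1), \<Lambda> (q, 1), \<Lambda> (w, 0)}"
      using v w by auto
    then have "\<Lambda> (v, 0) \<in> vec.span (\<Lambda> ` (?\<sigma> - {(v, 0)}))"
      using difference by (simp add: vec.span_add vec.span_scale vec.span_base)
    with face show False
      using char_map_not_in_span[OF char_map] by blast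
  qed
qed

text \<open>The only candidate allowed by \<open>realizes_vertex_eq\<close>.\<close>

definition canonical_realization :: "nat \<times> nat \<Rightarrow> bit^4" where
  "canonical_realization z =
     (if fst z = p then axis (if snd z = 1 then 1 else 2) 1
      else if fst z = q then axis (if snd z = 1 then 3 else 4) 1
      else vertex_vector (fst z))"

lemma canonical_realization_simps:
  "canonical_realization (p, 1) = axis 1 1" "canonical_realization (p, 2) = axis 2 1"
  "canonical_realization (q, 1) = axis 3 1" "canonical_realization (q, 2) = axis 4 1"
  using pq by (simp_all add: canonical_realization_def)

lemma wed_facet_cases:
  assumes "i < m" and "kp \<in> {1, 2}" and "kq \<in> {1, 2}"
  obtains (generic) "i \<notin> {p, q}" "Suc i mod m \<notin> {p, q}"
      "wed_facet i kp kq = {(p, kp), (q, kq), (i, 0), (Suc i mod m, 0)}"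
    | (near_p) v where "v < m" "v \<notin> {p, q}" "cycle_adjacent m v p"
      "wed_facet i kp kq = {(p, 1), (p, 2), (q, kq), (v, 0)}"
    | (near_q) v where "v < m" "v \<notin> {p, q}" "cycle_adjacent m v q"
      "wed_facet i kp kq = {(q, 1), (q, 2), (p, kp), (v, 0)}"
    | (pq_edge) "wed_facet i kp kq = {(p, 1), (p, 2), (q, 1), (q, 2)}"
proof -
  define i' where "i' = Suc i mod m"
  have "i' < m" "cycle_adjacent m i i'"
    using m unfolding i'_def cycle_adjacent_def by auto
  have "i' \<noteq> i"
    using m \<open>i < m\<close> unfolding i'_def by (cases "Suc i = m") auto
  have facet: "wed_facet i kp kq = wed_lift {p, q} {i, i'} \<union> {(p, kp), (q, kq)}"
    unfolding wed_facet_def i'_def ..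
  consider "p \<notin> {i, i'}" "q \<notin> {i, i'}" | "p \<in> {i, i'}" "q \<notin> {i, i'}"
    | "p \<notin> {i, i'}" "q \<in> {i, i'}" | "p \<in> {i, i'}" "q \<in> {i, i'}"
    by blast
  then show thesis
  proof cases
    case 1
    then have "wed_facet i kp kq = {(p, kp), (q, kq), (i, 0), (i', 0)}"
      using assms unfolding facet by auto
    with 1 show thesis
      using generic unfolding i'_def by blast
  next
    case 2
    define v where "v = (if p = i then i' else i)"
    have "v < m" "v \<notin> {p, q}" "cycle_adjacent m v p"
      using 2 \<open>i < m\<close> \<open>i' < m\<close> \<open>i' \<noteq> i\<close> \<open>cycle_adjacent m i i'\<close> cycle_adjacent_sym
      unfolding v_def by auto
    moreover have "wed_facet i kp kq = {(p, 1), (p, 2), (q, kq), (v, 0)}"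
      using 2 assms \<open>i' \<noteq> i\<close> unfolding facet v_def by auto
    ultimately show thesis
      by (rule near_p)
  next
    case 3
    define v where "v = (if q = i then i' else i)"
    have "v < m" "v \<notin> {p, q}" "cycle_adjacent m v q"
      using 3 \<open>i < m\<close> \<open>i' < m\<close> \<open>i' \<noteq> i\<close> \<open>cycle_adjacent m i i'\<close> cycle_adjacent_sym
      unfolding v_def by auto
    moreover have "wed_facet i kp kq = {(q, 1), (q, 2), (p, kp), (v, 0)}"
      using 3 assms \<open>i' \<noteq> i\<close> unfolding facet v_def by auto
    ultimately show thesis
      by (rule near_q)
  next
    case 4
    then have "wed_facet i kp kq = {(p, 1), (p, 2), (q, 1), (q, 2)}"
      using assms pq unfolding facet by auto
    then show thesis
      by (rule pq_edge)
  qed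
qed

lemma vertex_vectors_independent_on:
  assumes "\<not> degenerate" and "i < m" "i \<notin> {p, q}" "Suc i mod m \<notin> {p, q}"
    and "a \<in> {1, 2}" "b \<in> {3, 4}"
  defines "x \<equiv> vertex_vector i" and "y \<equiv> vertex_vector (Suc i mod m)"
  shows "(x$a \<noteq> 0 \<or> x$b \<noteq> 0) \<and> (y$a \<noteq> 0 \<or> y$b \<noteq> 0) \<and> (x$a \<noteq> y$a \<or> x$b \<noteq> y$b)"
proof -
  have "Suc i mod m < m" "cycle_adjacent m i (Suc i mod m)"
    using m unfolding cycle_adjacent_def by auto
  then have "admissible_bits x" "admissible_bits y" "compatible_bits x y"
    using vertex_vector_admissible vertex_vector_compatible \<open>i < m\<close> unfolding x_def y_def
    by blast+
  moreover have "\<not> degenerate_vertex i" "\<not> degenerate_vertex (Suc i mod m)" "\<not> degenerate_edge i"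
    using assms(1) unfolding degenerate_def by blast+
  then have "x$2 \<noteq> 0 \<or> x$4 \<noteq> 0" "y$2 \<noteq> 0 \<or> y$4 \<noteq> 0" "x$2 \<noteq> y$2 \<or> x$4 \<noteq> y$4"
    using assms(2-4) \<open>Suc i mod m < m\<close>
    unfolding degenerate_vertex_def degenerate_edge_def x_def y_def by auto
  ultimately show ?thesis
    using assms(5,6) unfolding admissible_bits_def compatible_bits_def
    by (elim insertE emptyE) simp_all
qed

lemma canonical_facet_independent:
  assumes "\<not> degenerate" and "i < m" and "kp \<in> {1, 2}" and "kq \<in> {1, 2}"
  shows "inj_on canonical_realization (wed_facet i kp kq) \<and>
    vec.independent (canonical_realization ` wed_facet i kp kq)"
  using assms(2-4)
proof (cases rule: wed_facet_cases)
  case generic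
  define jp jq a b where "jp = (if kp = 1 then 1 else 2 :: 4)"
    and "jq = (if kq = 1 then 3 else 4 :: 4)"
    and "a = (if kp = 1 then 2 else 1 :: 4)" and "b = (if kq = 1 then 4 else 3 :: 4)"
  have images: "canonical_realization (p, kp) = axis jp 1"
    "canonical_realization (q, kq) = axis jq 1"
    "canonical_realization (i, 0) = vertex_vector i"
    "canonical_realization (Suc i mod m, 0) = vertex_vector (Suc i mod m)"
    using assms(3,4) pq generic(1,2) unfolding jp_def jq_def canonical_realization_def by auto
  have "distinct [jp, jq, a, b]" "a \<in> {1, 2}" "b \<in> {3, 4}"
    using assms(3,4) unfolding jp_def jq_def a_def b_def by auto
  then have indep: "distinct [axis jp 1, axis jq 1, vertex_vector i, vertex_vector (Suc i mod m)] \<and>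
      vec.independent {axis jp 1, axis jq 1, vertex_vector i, vertex_vector (Suc i mod m)}"
    using independent_two_axes vertex_vectors_independent_on[OF assms(1,2) generic(1,2)] by blast
  show ?thesis
    unfolding generic(3)
    using inj_on_independent_image_4[of canonical_realization "(p, kp)" "(q, kq)" "(i, 0)"
        "(Suc i mod m, 0)", unfolded images] indep
    by blast
next
  case (near_p v)
  define jq jq' where "jq = (if kq = 1 then 3 else 4 :: 4)"
    and "jq' = (if kq = 1 then 4 else 3 :: 4)"
  have "vertex_vector v $ 3 \<noteq> 0" "vertex_vector v $ 4 \<noteq> 0"
    using char_Pm_adjacent_neq[OF char(1) near_p(1) p near_p(3)]
      char_Pm_adjacent_neq[OF char(3) near_p(1) p near_p(3)]
      char_Pm_eq_va_iff[OF char(1) near_p(1)] char_Pm_eq_va_iff[OF char(3) near_p(1)] at_p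
    by auto
  then have "distinct [1, 2, jq, jq']" "vertex_vector v $ jq' \<noteq> 0"
    unfolding jq_def jq'_def by auto
  then have indep: "distinct [axis 1 1, axis 2 1, axis jq 1, vertex_vector v] \<and>
      vec.independent {axis 1 1, axis 2 1, axis jq 1, vertex_vector v}"
    by (rule independent_three_axes)
  have images: "canonical_realization (p, 1) = axis 1 1" "canonical_realization (p, 2) = axis 2 1"
    "canonical_realization (q, kq) = axis jq 1" "canonical_realization (v, 0) = vertex_vector v"
    using assms(4) pq near_p(2) unfolding canonical_realization_def jq_def by auto
  show ?thesis
    unfolding near_p(4)
    using inj_on_independent_image_4[of canonical_realization "(p, 1)" "(p, 2)" "(q, kq)" "(v, 0)",
        unfolded images] indep
    by blast
next
  case (near_q v)
  define jp jp' where "jp = (if kp = 1 then 1 else 2 :: 4)"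
    and "jp' = (if kp = 1 then 2 else 1 :: 4)"
  have "vertex_vector v $ 1 \<noteq> 0" "vertex_vector v $ 2 \<noteq> 0"
    using char_Pm_adjacent_neq[OF char(1) near_q(1) q near_q(3)]
      char_Pm_adjacent_neq[OF char(2) near_q(1) q near_q(3)]
      char_Pm_eq_vb_iff[OF char(1) near_q(1)] char_Pm_eq_vb_iff[OF char(2) near_q(1)] at_q
    by auto
  then have "distinct [3, 4, jp, jp']" "vertex_vector v $ jp' \<noteq> 0"
    unfolding jp_def jp'_def by auto
  then have indep: "distinct [axis 3 1, axis 4 1, axis jp 1, vertex_vector v] \<and>
      vec.independent {axis 3 1, axis 4 1, axis jp 1, vertex_vector v}"
    by (rule independent_three_axes)
  have images: "canonical_realization (q, 1) = axis 3 1" "canonical_realization (q, 2) = axis 4 1"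
    "canonical_realization (p, kp) = axis jp 1" "canonical_realization (v, 0) = vertex_vector v"
    using assms(3) pq near_q(2) unfolding canonical_realization_def jp_def by auto
  show ?thesis
    unfolding near_q(4)
    using inj_on_independent_image_4[of canonical_realization "(q, 1)" "(q, 2)" "(p, kp)" "(v, 0)",
        unfolded images] indep
    by blast
next
  case pq_edge
  have "distinct [axis 1 1, axis 2 1, axis 3 1, axis (4::4) (1::bit)] \<and>
      vec.independent {axis 1 1, axis 2 1, axis 3 1, axis (4::4) (1::bit)}"
    by (rule independent_three_axes) (simp_all add: axis_nth_bit)
  then show ?thesis
    unfolding pq_edge
    using inj_on_independent_image_4[of canonical_realization "(p, 1)" "(p, 2)" "(q, 1)" "(q, 2)",
        unfolded canonical_realization_simps]
    by blast
qed

lemma canonical_realization_char_map: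
  assumes "\<not> degenerate"
  shows "char_map wed_pq canonical_realization"
  unfolding char_map_def
proof
  fix \<sigma> assume "\<sigma> \<in> wed_pq"
  then obtain i kp kq where "i < m" "kp \<in> {1, 2}" "kq \<in> {1, 2}" "\<sigma> \<subseteq> wed_facet i kp kq"
    by (rule wed_pq_face_subset_facet)
  with canonical_facet_independent[OF assms] show
    "inj_on canonical_realization \<sigma> \<and> vec.independent (canonical_realization ` \<sigma>)"
    by (meson image_mono inj_on_subset vec.independent_mono)
qed

lemma canonical_realization_realizes:
  assumes "\<not> degenerate"
  shows "realizes canonical_realization"
  unfolding realizes_def
proof (intro conjI)
  show "char_map wed_pq canonical_realization"
    using canonical_realization_char_map[OF assms] .
  have vertex: "coord_proj 1 3 (vertex_vector w) = l1 w" "coord_proj 2 3 (vertex_vector w) = l2 w"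
    "coord_proj 1 4 (vertex_vector w) = l3 w" if "w < m" for w
    using l2_nth_1[OF that] l3_nth_2[OF that] by (simp_all add: vec2_eq_iff)
  show "proj_equiv m canonical_realization {(p, 2), (q, 2)} (wid {p, q} (\<lambda>_. 1)) l1"
    by (rule proj_equiv_coord_projI[of 1 3 2 4])
      (use vertex at_p at_q pq in
        \<open>auto simp: wid_def canonical_realization_def vec2_eq_iff axis_nth_bit\<close>)
  show "proj_equiv m canonical_realization {(p, 1), (q, 2)}
      (wid {p, q} (\<lambda>v. if v = p then 2 else 1)) l2"
    by (rule proj_equiv_coord_projI[of 2 3 1 4])
      (use vertex at_p at_q pq in
        \<open>auto simp: wid_def canonical_realization_def vec2_eq_iff axis_nth_bit\<close>)
  show "proj_equiv m canonical_realization {(p, 2), (q, 1)}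
      (wid {p, q} (\<lambda>v. if v = p then 1 else 2)) l3"
    by (rule proj_equiv_coord_projI[of 1 4 2 3])
      (use vertex at_p at_q pq in
        \<open>auto simp: wid_def canonical_realization_def vec2_eq_iff axis_nth_bit\<close>)
qed

lemma realizable_iff_not_degenerate: "(\<exists>\<Lambda>. realizes \<Lambda>) \<longleftrightarrow> \<not> degenerate"
  using realizes_imp_not_degenerate canonical_realization_realizes by blast

end

theorem lemma3:
  fixes m p q :: nat and l1 l2 l3 :: "nat \<Rightarrow> bit^2"
  assumes "m \<ge> 3" and "p < m" and "q < m" and "p \<noteq> q"
    and "char_Pm m l1" and "char_Pm m l2" and "char_Pm m l3"
    and "l1 p = va" and "l2 p = va" and "l3 p = va"
    and "l1 q = vb" and "l2 q = vb" and "l3 q = vb"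
    and "p_adjacent m p l1 l2" and "p_adjacent m q l1 l3"
  shows "((\<exists>\<Lambda> :: nat \<times> nat \<Rightarrow> bit^4.
             char_map (wed {0..<m} {p, q} (Pm_faces m)) \<Lambda> \<and>
             proj_equiv m \<Lambda> {(p, 2), (q, 2)} (wid {p, q} (\<lambda>_. 1)) l1 \<and>
             proj_equiv m \<Lambda> {(p, 1), (q, 2)} (wid {p, q} (\<lambda>v. if v = p then 2 else 1)) l2 \<and>
             proj_equiv m \<Lambda> {(p, 2), (q, 1)} (wid {p, q} (\<lambda>v. if v = p then 1 else 2)) l3)
          \<longleftrightarrow> nbhd m (sdiff_maps m l1 l2) \<inter> sdiff_maps m l1 l3 = {})
       \<and> (nbhd m (sdiff_maps m l1 l2) \<inter> sdiff_maps m l1 l3 = {}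
          \<longleftrightarrow> nbhd m (sdiff_maps m l1 l2) \<inter> nbhd m (sdiff_maps m l1 l3) = {})"
proof -
  interpret adjacent_square m p q l1 l2 l3
  proof
    show "l2 v $ 1 = l1 v $ 1" if "v < m" for v
      using p_adjacent_nth_1_eq assms that by blast
    show "l3 v $ 2 = l1 v $ 2" if "v < m" for v
      using p_adjacent_nth_2_eq assms that by blast
  qed (use assms in auto)
  show ?thesis
    using realizable_iff_not_degenerate nbhd_sdiff_disjoint_iff close_sdiffs_iff_degenerate
      nbhd_sdiffs_disjoint_iff
    unfolding realizes_def by blast
qed

end
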